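(* Let $H\in\mathbb{C}^{N\times N}$ be Hermitian negative definite. For every $\epsilon>0$ there exists $\delta>0$ such that $0\le\mu<\delta$ implies $d(S_\mu^{\mathrm{loc}},C_p)<\epsilon$.
   Context: $N,m$ are positive integers. For $X\in\mathbb{C}^{N\times m}$, $E_0(X)=\operatorname{tr}\bigl[(2I-X^*X)X^*HX\bigr]$, where $X^*$ is the conjugate transpose, and for $\mu\ge0$, $E_\mu(X)=E_0(X)+\mu\sum_{i,j}|X_{ij}|$. $S_\mu^{\mathrm{loc}}$ is the set of local minimizers of $E_\mu$ over $\mathbb{C}^{N\times m}$. $C_p$ is the set of critical points of $E_0$, i.e. the $X\in\mathbb{C}^{N\times m}$ at which the gradient of $E_0$, regarded as a real-valued function of the real and imaginary parts of the entries of $X$, vanishes (equivalently, $\nabla E_0(X)=-2XX^*HX+4HX-2HXX^*X=0$). For sets $A,B\subset\mathbb{C}^{N\times m}$, $d(A,B)=\sup_{a\in A}\inf_{b\in B}\|a-b\|_F$, where $\|\cdot\|_F$ is the Frobenius norm. *)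

theory Defs
  imports "HOL-Analysis.Analysis"
begin

text \<open>
  An \<open>N \<times> m\<close> complex matrix is an element of \<open>complex ^ 'm ^ 'n\<close> with \<open>N = CARD('n)\<close> and
  \<open>m = CARD('m)\<close>.  The norm of this type is the Frobenius norm (lemma \<open>norm_eq_Frobenius\<close>), and
  its real inner product is the Euclidean one in the real and imaginary parts of the entries
  (lemma \<open>inner_eq_Re_Im\<close>).
\<close>

definition ctranspose :: "complex ^ 'm ^ 'n \<Rightarrow> complex ^ 'n ^ 'm" where
  "ctranspose X = (\<chi> i j. cnj (X $ j $ i))"

definition hermitian :: "complex ^ 'n ^ 'n \<Rightarrow> bool" where
  "hermitian H \<longleftrightarrow> ctranspose H = H"

text \<open>Only used for Hermitian \<open>H\<close>, where the form \<open>v\<^sup>* H v\<close> is real (lemma \<open>Im_form_eq_0\<close>).\<close>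

definition negative_definite :: "complex ^ 'n ^ 'n \<Rightarrow> bool" where
  "negative_definite H \<longleftrightarrow> (\<forall>v. v \<noteq> 0 \<longrightarrow> Re (\<Sum>i\<in>UNIV. cnj (v $ i) * (H *v v) $ i) < 0)"

text \<open>
  The trace below is real for Hermitian \<open>H\<close> (lemma \<open>Im_trace_eq_0\<close>), so that taking the real part
  only changes the type.  Note that \<open>mat 2\<close> is \<open>2I\<close>.
\<close>

definition E\<^sub>0 :: "complex ^ 'n ^ 'n \<Rightarrow> complex ^ 'm ^ 'n \<Rightarrow> real" where
  "E\<^sub>0 H X = Re (trace ((mat 2 - ctranspose X ** X) ** (ctranspose X ** H ** X)))"

definition E :: "complex ^ 'n ^ 'n \<Rightarrow> real \<Rightarrow> complex ^ 'm ^ 'n \<Rightarrow> real" where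
  "E H \<mu> X = E\<^sub>0 H X + \<mu> * (\<Sum>i\<in>UNIV. \<Sum>j\<in>UNIV. cmod (X $ i $ j))"

definition local_minimizers :: "('a::topological_space \<Rightarrow> real) \<Rightarrow> 'a set" where
  "local_minimizers f = {x. \<forall>\<^sub>F y in nhds x. f x \<le> f y}"

definition S_loc :: "complex ^ 'n ^ 'n \<Rightarrow> real \<Rightarrow> (complex ^ 'm ^ 'n) set" where
  "S_loc H \<mu> = local_minimizers (E H \<mu>)"

definition C\<^sub>p :: "complex ^ 'n ^ 'n \<Rightarrow> (complex ^ 'm ^ 'n) set" where
  "C\<^sub>p H = {X. GDERIV (E\<^sub>0 H) X :> 0}"

text \<open>
  The values lie in \<open>[0, \<infinity>]\<close>: the supremum over an unbounded set may be infinite, and the supremum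
  over the empty set is \<open>0\<close>.
\<close>

definition dist_sets :: "'a::real_normed_vector set \<Rightarrow> 'a set \<Rightarrow> ennreal" where
  "dist_sets A B = (SUP a\<in>A. INF b\<in>B. ennreal (norm (a - b)))"

lemma norm_eq_Frobenius:
  fixes X :: "complex ^ 'm ^ 'n"
  shows "norm X = sqrt (\<Sum>i\<in>UNIV. \<Sum>j\<in>UNIV. (cmod (X $ i $ j))\<^sup>2)"
  by (simp add: norm_vec_def L2_set_def sum_nonneg)

lemma inner_eq_Re_Im:
  fixes X Y :: "complex ^ 'm ^ 'n"
  shows "X \<bullet> Y = (\<Sum>i\<in>UNIV. \<Sum>j\<in>UNIV. Re (X $ i $ j) * Re (Y $ i $ j) + Im (X $ i $ j) * Im (Y $ i $ j))"
  by (simp add: inner_vec_def inner_complex_def)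

lemma ctranspose_ctranspose: "ctranspose (ctranspose X) = X"
  by (simp add: ctranspose_def vec_eq_iff)

lemma ctranspose_mult:
  fixes A :: "complex ^ 'm ^ 'n" and B :: "complex ^ 'k ^ 'm"
  shows "ctranspose (A ** B) = ctranspose B ** ctranspose A"
  by (simp add: ctranspose_def matrix_matrix_mult_def vec_eq_iff mult.commute)

lemma ctranspose_diff: "ctranspose (A - B) = ctranspose A - ctranspose B"
  by (simp add: ctranspose_def vec_eq_iff)

lemma ctranspose_mat_2: "ctranspose (mat 2) = mat 2"
  by (auto simp add: ctranspose_def mat_def vec_eq_iff)

lemma trace_ctranspose: "trace (ctranspose A) = cnj (trace A)"
  by (simp add: trace_def ctranspose_def)

lemma Im_eq_0_if_cnj_eq: "Im z = 0" if "cnj z = z"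
  using arg_cong[OF that, of Im] by simp

lemma Im_form_eq_0:
  fixes H :: "complex ^ 'n ^ 'n"
  assumes "hermitian H"
  shows "Im (\<Sum>i\<in>UNIV. cnj (v $ i) * (H *v v) $ i) = 0"
proof -
  have H: "cnj (H $ i $ j) = H $ j $ i" for i j
    using assms by (simp add: hermitian_def ctranspose_def vec_eq_iff)
  let ?q = "\<Sum>i\<in>UNIV. \<Sum>j\<in>UNIV. cnj (v $ i) * (H $ i $ j * v $ j)"
  have "cnj ?q = (\<Sum>i\<in>UNIV. \<Sum>j\<in>UNIV. cnj (v $ j) * (H $ j $ i * v $ i))"
    by (simp add: H mult_ac)
  also have "\<dots> = ?q"
    by (rule sum.swap)
  finally have "Im ?q = 0"
    by (rule Im_eq_0_if_cnj_eq)
  then show ?thesis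
    by (simp add: matrix_vector_mult_def sum_distrib_left)
qed

lemma Im_trace_eq_0:
  fixes H :: "complex ^ 'n ^ 'n" and X :: "complex ^ 'm ^ 'n"
  assumes "hermitian H"
  shows "Im (trace ((mat 2 - ctranspose X ** X) ** (ctranspose X ** H ** X))) = 0"
proof -
  let ?A = "mat 2 - ctranspose X ** X" and ?B = "ctranspose X ** H ** X"
  have "ctranspose ?A = ?A"
    by (simp add: ctranspose_diff ctranspose_mat_2 ctranspose_mult ctranspose_ctranspose)
  moreover have "ctranspose ?B = ?B"
    using assms
    by (simp add: hermitian_def ctranspose_mult ctranspose_ctranspose matrix_mul_assoc)
  ultimately have "cnj (trace (?A ** ?B)) = trace (?A ** ?B)"
    using trace_ctranspose[of "?A ** ?B"] trace_mul_sym[of ?A ?B]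
    by (simp only: ctranspose_mult)
  then show ?thesis
    by (rule Im_eq_0_if_cnj_eq)
qed

end

theory Submission imports Defs begin

text \<open>
  At a local minimizer of \<open>E H \<mu>\<close> every directional derivative of \<open>E\<^sub>0 H\<close> is at most
  \<open>\<mu>\<close> times the entrywise norm of the direction.  In the direction \<open>X\<close> this derivative is
  \<open>4 tr (X\<^sup>* H X) - 4 tr (Y\<^sup>* H Y)\<close> with \<open>Y = X X\<^sup>*\<close>, which grows like the fourth power of the
  norm because \<open>H\<close> is negative definite; so for \<open>\<mu> \<le> 1\<close> all local minimizers lie in one
  fixed ball.  The points of this ball that keep a distance from the critical set form a compact set,
  on which the derivative is bounded away from zero, so a small \<open>\<mu>\<close> excludes local minimizers there.
\<close>

section \<open>Minima, one-sided derivatives and distances in general spaces\<close>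

text \<open>Compactness of the unit sphere yields a minimizer \<open>u\<close>, and homogeneity of
  degree 2 carries the bound to all vectors. Exporting \<open>u\<close> rather than the minimum lets
  definiteness of \<open>f\<close> decide the sign of the constant.\<close>

lemma quadratic_ge_unit_value:
  fixes f :: "'a::euclidean_space \<Rightarrow> real"
  assumes cont: "continuous_on UNIV f"
    and hom: "\<And>c x. f (c *\<^sub>R x) = c\<^sup>2 * f x"
  obtains u where "norm u = 1" "\<And>x. f u * (norm x)\<^sup>2 \<le> f x"
proof -
  have "\<exists>u\<in>sphere 0 1. \<forall>x\<in>sphere 0 1. f u \<le> f x"
  proof (rule continuous_attains_inf)
    show "sphere (0::'a) 1 \<noteq> {}"
      by simp
  qed (auto intro: continuous_on_subset[OF cont])
  then obtain u where u: "norm u = 1" "\<And>x. norm x = 1 \<Longrightarrow> f u \<le> f x"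
    by auto
  have "f u * (norm x)\<^sup>2 \<le> f x" for x
  proof (cases "x = 0")
    case True
    then show ?thesis using hom[of 0 x] by simp
  next
    case False
    then have "f u \<le> f (x /\<^sub>R norm x)"
      by (intro u) simp
    also have "\<dots> = f x / (norm x)\<^sup>2"
      by (simp add: hom power_inverse divide_inverse mult.commute)
    finally show ?thesis
      using False by (simp add: field_simps)
  qed
  with u show thesis by (intro that) auto
qed

text \<open>For small \<open>t > 0\<close>, minimality and the bound on \<open>g\<close> give
  \<open>f (x + t *\<^sub>R v) - f x \<ge> - \<mu> * t * g v\<close>; divide by \<open>t\<close> and
  let \<open>t\<close> tend to 0. Differentiability is asked of \<open>f\<close> alone, so
  \<open>g\<close> may have kinks, as the entrywise norm does.\<close>

lemma local_minimizer_directional_bound: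
  fixes f g :: "'a::real_normed_vector \<Rightarrow> real"
  assumes der: "(f has_derivative D) (at x)"
    and min: "x \<in> local_minimizers (\<lambda>y. f y + \<mu> * g y)"
    and g: "\<And>t. t > 0 \<Longrightarrow> g (x + t *\<^sub>R v) \<le> g x + t * g v"
    and "0 \<le> \<mu>"
  shows "- (\<mu> * g v) \<le> D v"
proof -
  have "((\<lambda>t::real. x + t *\<^sub>R v) has_derivative (\<lambda>t. t *\<^sub>R v)) (at 0)"
    by (auto intro!: derivative_eq_intros)
  from has_derivative_compose[OF this, of f D]
  have "((\<lambda>t. f (x + t *\<^sub>R v)) has_derivative (\<lambda>t. D (t *\<^sub>R v))) (at 0)"
    using der by simp
  moreover have "(\<lambda>t. D (t *\<^sub>R v)) = (*) (D v)"
    using has_derivative_linear[OF der] by (auto simp: linear_cmul)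
  ultimately have "((\<lambda>t. f (x + t *\<^sub>R v)) has_real_derivative D v) (at 0)"
    by (simp add: has_field_derivative_def)
  \<comment> \<open>The limit is restricted to the right, where the bound on \<open>g\<close> is
    available and division by \<open>t\<close> keeps the inequality.\<close>
  then have "((\<lambda>t. (f (x + t *\<^sub>R v) - f x) / t) \<longlongrightarrow> D v) (at_right 0)"
    by (auto simp: has_field_derivative_iff intro: tendsto_mono[OF at_le])
  moreover have "\<forall>\<^sub>F t in at_right 0. - (\<mu> * g v) \<le> (f (x + t *\<^sub>R v) - f x) / t"
  proof -
    have "((\<lambda>t::real. x + t *\<^sub>R v) \<longlongrightarrow> x + 0 *\<^sub>R v) (at_right 0)"
      by (intro tendsto_intros)
    then have "filterlim (\<lambda>t::real. x + t *\<^sub>R v) (nhds x) (at_right 0)"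
      by simp
    moreover have "\<forall>\<^sub>F y in nhds x. f x + \<mu> * g x \<le> f y + \<mu> * g y"
      using min by (simp add: local_minimizers_def)
    ultimately have "\<forall>\<^sub>F t in at_right 0.
        f x + \<mu> * g x \<le> f (x + t *\<^sub>R v) + \<mu> * g (x + t *\<^sub>R v)"
      by (rule eventually_compose_filterlim[rotated])
    moreover have "\<forall>\<^sub>F t::real in at_right 0. t > 0"
      by (simp add: eventually_at_right_less)
    ultimately show ?thesis
    proof eventually_elim
      case (elim t)
      have "\<mu> * g (x + t *\<^sub>R v) \<le> \<mu> * (g x + t * g v)"
        using g[OF elim(2)] \<open>0 \<le> \<mu>\<close> by (rule mult_left_mono)
      with elim show ?case
        by (simp add: field_simps)
    qed
  qed
  ultimately show ?thesis
    by (intro tendsto_lowerbound) auto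
qed

text \<open>The points of \<open>K\<close> at distance at least \<open>e\<close> from
  \<open>C\<close> form a compact set on which \<open>\<phi>\<close> is positive; its minimum there
  serves as \<open>c\<close>.\<close>

lemma near_zero_set_if_small:
  fixes \<phi> :: "'a::metric_space \<Rightarrow> real"
  assumes "compact K" "continuous_on K \<phi>" "\<And>x. x \<in> K \<Longrightarrow> 0 \<le> \<phi> x"
    and "\<And>x. x \<in> K \<Longrightarrow> \<phi> x = 0 \<Longrightarrow> x \<in> C"
    and "0 < e"
  obtains c where "0 < c" "\<And>x. x \<in> K \<Longrightarrow> \<phi> x < c \<Longrightarrow> infdist x C < e"
proof -
  let ?K = "K \<inter> {x. e \<le> infdist x C}"
  have "closed {x. e \<le> infdist x C}"
    by (intro closed_Collect_le continuous_intros)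
  then have K: "compact ?K"
    by (rule compact_Int_closed[OF \<open>compact K\<close>])
  show thesis
  proof (cases "?K = {}")
    case True
    \<comment> \<open>All of \<open>K\<close> is already within \<open>e\<close> of
      \<open>C\<close>, so any positive \<open>c\<close> would do.\<close>
    then show ?thesis by (intro that[of 1]) force+
  next
    case False
    then obtain y where y: "y \<in> ?K" "\<And>x. x \<in> ?K \<Longrightarrow> \<phi> y \<le> \<phi> x"
      using continuous_attains_inf[OF K, of \<phi>] continuous_on_subset[OF assms(2)] by blast
    have "\<phi> y \<noteq> 0"
    proof
      assume "\<phi> y = 0"
      then have "y \<in> C" using y assms(4) by blast
      then show False using y \<open>0 < e\<close> by (simp add: infdist_zero)
    qed
    then have "0 < \<phi> y"
      using y assms(3)[of y] by simp
    then show ?thesis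
      using y(2) by (intro that[of "\<phi> y"]) force+
  qed
qed

text \<open>For empty \<open>B\<close> the value of \<open>infdist\<close> is 0 by convention, while
  the infimum in \<open>dist_sets\<close> is infinite; hence the first premise. The supremum turns
  the strict bounds into a weak one.\<close>

lemma dist_sets_le:
  assumes "B \<noteq> {}" "\<And>a. a \<in> A \<Longrightarrow> infdist a B < e"
  shows "dist_sets A B \<le> ennreal e"
  unfolding dist_sets_def
proof (rule SUP_least)
  fix a assume "a \<in> A"
  then have "(INF b\<in>B. dist a b) < e"
    using assms by (simp add: infdist_def)
  then obtain b where "b \<in> B" "dist a b < e"
    using \<open>B \<noteq> {}\<close> by (subst (asm) cINF_less_iff) auto
  then show "(INF b\<in>B. ennreal (norm (a - b))) \<le> ennreal e"
    by (intro INF_lower2[of b]) (auto simp: dist_norm intro: ennreal_leI)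
qed

section \<open>Real-linear calculus of matrix products, adjoints and traces\<close>

lemma scaleR_matrix_mult:
  fixes A :: "complex ^ 'm ^ 'n" and B :: "complex ^ 'k ^ 'm"
  shows "(r *\<^sub>R A) ** B = r *\<^sub>R (A ** B)" "A ** (r *\<^sub>R B) = r *\<^sub>R (A ** B)"
  by (simp_all add: matrix_matrix_mult_def vec_eq_iff scaleR_sum_right)

lemma matrix_mult_add_left:
  fixes A B :: "complex ^ 'm ^ 'n"
  shows "(A + B) ** C = A ** C + B ** C"
  by (simp add: matrix_matrix_mult_def vec_eq_iff distrib_right sum.distrib)

lemma bounded_bilinear_matrix_mult:
  "bounded_bilinear ((**) :: complex ^ 'm ^ 'n \<Rightarrow> complex ^ 'k ^ 'm \<Rightarrow> complex ^ 'k ^ 'n)"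
  unfolding bilinear_conv_bounded_bilinear[symmetric] bilinear_def
  by (auto intro!: linearI simp: matrix_add_ldistrib matrix_mult_add_left scaleR_matrix_mult)

text \<open>The adjoint is conjugate-linear over the complex numbers, so linearity and derivatives
  are taken over the reals.\<close>

lemma bounded_linear_ctranspose:
  "bounded_linear (ctranspose :: complex ^ 'm ^ 'n \<Rightarrow> complex ^ 'n ^ 'm)"
  unfolding linear_conv_bounded_linear[symmetric]
  by (auto intro!: linearI simp: ctranspose_def vec_eq_iff)

lemma bounded_linear_Re_trace:
  "bounded_linear (\<lambda>A :: complex ^ 'n ^ 'n. Re (trace A))"
  unfolding linear_conv_bounded_linear[symmetric]
  by (auto intro!: linearI simp: trace_def sum.distrib sum_distrib_left)

lemmas matrix_derivative_intros =
  bounded_bilinear.FDERIV[OF bounded_bilinear_matrix_mult]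
  bounded_linear.has_derivative[OF bounded_linear_ctranspose]
  bounded_linear.has_derivative[OF bounded_linear_Re_trace]

lemmas matrix_continuous_intros =
  bounded_bilinear.continuous_on[OF bounded_bilinear_matrix_mult]
  bounded_linear.continuous_on[OF bounded_linear_ctranspose]
  bounded_linear.continuous_on[OF bounded_linear_Re_trace]

lemmas ctranspose_scaleR = linear_cmul[OF bounded_linear.linear[OF bounded_linear_ctranspose]]
lemmas Re_trace_scaleR = linear_cmul[OF bounded_linear.linear[OF bounded_linear_Re_trace]]
lemmas Re_trace_add = linear_add[OF bounded_linear.linear[OF bounded_linear_Re_trace]]
lemmas Re_trace_diff = linear_diff[OF bounded_linear.linear[OF bounded_linear_Re_trace]]

section \<open>The trace form of \<open>H\<close> and the derivative of
  \<open>E\<^sub>0\<close>\<close>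

text \<open>The number of columns is left arbitrary, so that the form applies both to
  \<open>X\<close> and to the square matrix \<open>X ** ctranspose X\<close>.\<close>

definition quad :: "complex ^ 'n ^ 'n \<Rightarrow> complex ^ 'm ^ 'n \<Rightarrow> real" where
  "quad H X = Re (trace (ctranspose X ** (H ** X)))"

lemma continuous_on_quad: "continuous_on S (quad H)"
  unfolding quad_def by (intro matrix_continuous_intros continuous_intros)

lemma quad_scaleR: "quad H (c *\<^sub>R X) = c\<^sup>2 * quad H X"
  by (simp add: quad_def ctranspose_scaleR scaleR_matrix_mult Re_trace_scaleR power2_eq_square)

lemma E\<^sub>0_eq_quad:
  fixes H :: "complex ^ 'n ^ 'n" and X :: "complex ^ 'm ^ 'n"
  shows "E\<^sub>0 H X = 2 * quad H X - quad H (X ** ctranspose X)"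
proof -
  have "mat 2 ** B = 2 *\<^sub>R B" for B :: "complex ^ 'm ^ 'm"
    by (simp add: matrix_matrix_mult_def mat_def vec_eq_iff if_distrib[of "\<lambda>x. x * _"]
        scaleR_conv_of_real cong: if_cong)
  moreover have "trace ((ctranspose X ** X) ** (ctranspose X ** H ** X))
      = trace (ctranspose (X ** ctranspose X) ** (H ** (X ** ctranspose X)))"
    \<comment> \<open>Cyclicity moves the leading adjoint to the end, and
      \<open>X ** ctranspose X\<close> is its own adjoint.\<close>
    using trace_mul_sym[of "ctranspose X" "X ** (ctranspose X ** H ** X)"]
    by (simp add: ctranspose_mult ctranspose_ctranspose matrix_mul_assoc)
  ultimately show ?thesis
    by (simp add: E\<^sub>0_def quad_def bounded_bilinear.diff_left[OF bounded_bilinear_matrix_mult]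
        Re_trace_diff Re_trace_scaleR matrix_mul_assoc[symmetric])
qed

text \<open>The derivative of \<open>quad H\<close> at \<open>X\<close> along \<open>V\<close>, in
  the form given by the product rule.\<close>

definition quad_deriv :: "complex ^ 'n ^ 'n \<Rightarrow> complex ^ 'm ^ 'n \<Rightarrow> complex ^ 'm ^ 'n \<Rightarrow> real" where
  "quad_deriv H X V = Re (trace (ctranspose X ** (H ** V) + ctranspose V ** (H ** X)))"

definition E\<^sub>0_deriv :: "complex ^ 'n ^ 'n \<Rightarrow> complex ^ 'm ^ 'n \<Rightarrow> complex ^ 'm ^ 'n \<Rightarrow> real" where
  "E\<^sub>0_deriv H X V = 2 * quad_deriv H X V
    - quad_deriv H (X ** ctranspose X) (X ** ctranspose V + V ** ctranspose X)"

lemma has_derivative_quad: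
  assumes "(f has_derivative f') (at x)"
  shows "((\<lambda>x. quad H (f x)) has_derivative (\<lambda>v. quad_deriv H (f x) (f' v))) (at x)"
proof -
  have "((\<lambda>x. H ** f x) has_derivative (\<lambda>v. H ** f' v)) (at x)"
    by (rule bounded_linear.has_derivative[OF
        bounded_bilinear.bounded_linear_right[OF bounded_bilinear_matrix_mult] assms])
  then show ?thesis
    unfolding quad_def quad_deriv_def by (intro matrix_derivative_intros assms)
qed

lemma has_derivative_E\<^sub>0: "(E\<^sub>0 H has_derivative E\<^sub>0_deriv H X) (at X)"
proof -
  have "((\<lambda>X. X ** ctranspose X) has_derivative
      (\<lambda>V. X ** ctranspose V + V ** ctranspose X)) (at X)"
    by (intro matrix_derivative_intros has_derivative_ident)
  then show ?thesis
    unfolding E\<^sub>0_eq_quad[abs_def] E\<^sub>0_deriv_def[abs_def]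
    by (intro derivative_intros has_derivative_quad)
qed

lemma continuous_on_E\<^sub>0_deriv: "continuous_on S (\<lambda>X. E\<^sub>0_deriv H X V)"
  unfolding E\<^sub>0_deriv_def quad_deriv_def
  by (intro matrix_continuous_intros continuous_intros)

lemma quad_deriv_self: "quad_deriv H X X = 2 * quad H X"
  by (simp only: quad_deriv_def quad_def Re_trace_add mult_2)

lemma quad_deriv_scaleR: "quad_deriv H X (c *\<^sub>R V) = c * quad_deriv H X V"
  by (simp only: quad_deriv_def ctranspose_scaleR scaleR_matrix_mult Re_trace_scaleR Re_trace_add
      distrib_left real_scaleR_def)

text \<open>Euler's relation: the two terms of \<open>E\<^sub>0\<close> are homogeneous of degrees 2
  and 4 in \<open>X\<close>.\<close>

lemma E\<^sub>0_deriv_self: "E\<^sub>0_deriv H X X = 4 * quad H X - 4 * quad H (X ** ctranspose X)"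
  by (simp only: E\<^sub>0_deriv_def scaleR_2[symmetric] quad_deriv_scaleR quad_deriv_self)

lemma quad_eq_sum_columns:
  "quad H X = (\<Sum>k\<in>UNIV. Re (\<Sum>i\<in>UNIV. cnj (column k X $ i) * (H *v column k X) $ i))"
  by (simp add: quad_def trace_def matrix_matrix_mult_def ctranspose_def column_def
      matrix_vector_mult_def)

text \<open>The form is a sum over the columns of \<open>X\<close>: a nonzero column contributes a
  negative term, and no column a positive one.\<close>

lemma quad_neg:
  assumes "negative_definite H" "X \<noteq> 0"
  shows "quad H X < 0"
proof -
  define q where "q v = Re (\<Sum>i\<in>UNIV. cnj (v $ i) * (H *v v) $ i)" for v
  have neg: "q v < 0" if "v \<noteq> 0" for v
    using assms(1) that by (simp add: negative_definite_def q_def)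
  obtain i k where "X $ i $ k \<noteq> 0"
    using assms(2) by (auto simp: vec_eq_iff)
  then have "q (column k X) < 0"
    by (intro neg) (auto simp: column_def vec_eq_iff)
  moreover have "q v \<le> 0" for v
    using neg[of v] by (cases "v = 0") (auto simp: q_def)
  ultimately show ?thesis
    unfolding quad_eq_sum_columns q_def[symmetric]
    by (subst sum.remove[of _ k]) (auto intro!: add_neg_nonpos sum_nonpos)
qed

text \<open>The squared Frobenius norm is the trace of \<open>X ** ctranspose X\<close>, whose
  diagonal entries are each at most the norm of that matrix. This makes the quartic term of
  \<open>E\<^sub>0\<close> comparable to the fourth power of \<open>norm X\<close>.\<close>

lemma norm_power2_le_norm_mult_ctranspose:
  fixes X :: "complex ^ 'm ^ 'n"
  shows "(norm X)\<^sup>2 \<le> real CARD('n) * norm (X ** ctranspose X)"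
proof -
  have "(norm X)\<^sup>2 = (\<Sum>i\<in>UNIV. \<Sum>j\<in>UNIV. (cmod (X $ i $ j))\<^sup>2)"
    by (simp add: norm_eq_Frobenius sum_nonneg)
  also have "\<dots> = (\<Sum>i\<in>UNIV. Re ((X ** ctranspose X) $ i $ i))"
    by (simp add: matrix_matrix_mult_def ctranspose_def complex_mult_cnj cmod_power2)
  also have "\<dots> \<le> (\<Sum>i\<in>(UNIV::'n set). norm (X ** ctranspose X))"
  proof (rule sum_mono)
    fix i :: 'n
    let ?Y = "X ** ctranspose X"
    have "Re (?Y $ i $ i) \<le> cmod (?Y $ i $ i)" by (rule complex_Re_le_cmod)
    also have "\<dots> \<le> norm (?Y $ i)" by (rule Finite_Cartesian_Product.norm_nth_le)
    also have "\<dots> \<le> norm ?Y" by (rule Finite_Cartesian_Product.norm_nth_le)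
    finally show "Re (?Y $ i $ i) \<le> norm ?Y" .
  qed
  finally show ?thesis by simp
qed

section \<open>The entrywise norm and bounds on local minimizers\<close>

definition entry_norm :: "complex ^ 'm ^ 'n \<Rightarrow> real" where
  "entry_norm X = (\<Sum>i\<in>UNIV. \<Sum>j\<in>UNIV. cmod (X $ i $ j))"

lemma entry_norm_nonneg: "0 \<le> entry_norm X"
  unfolding entry_norm_def by (intro sum_nonneg) auto

lemma entry_norm_minus: "entry_norm (- X) = entry_norm X"
  by (simp add: entry_norm_def)

lemma entry_norm_add_scaleR:
  assumes "0 < t"
  shows "entry_norm (X + t *\<^sub>R V) \<le> entry_norm X + t * entry_norm V"
proof -
  have "cmod (X $ i $ j + t *\<^sub>R V $ i $ j) \<le> cmod (X $ i $ j) + t * cmod (V $ i $ j)" for i j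
    using norm_triangle_ineq[of "X $ i $ j" "t *\<^sub>R V $ i $ j"] assms by simp
  then show ?thesis
    unfolding entry_norm_def sum_distrib_left sum.distrib[symmetric] by (intro sum_mono) simp
qed

lemma entry_norm_le:
  fixes X :: "complex ^ 'm ^ 'n"
  shows "entry_norm X \<le> real (CARD('n) * CARD('m)) * norm X"
proof -
  have "cmod (X $ i $ j) \<le> norm X" for i j
    by (metis Finite_Cartesian_Product.norm_nth_le order_trans)
  then have "entry_norm X \<le> (\<Sum>i\<in>(UNIV::'n set). \<Sum>j\<in>(UNIV::'m set). norm X)"
    unfolding entry_norm_def by (intro sum_mono)
  then show ?thesis by simp
qed

text \<open>The one-sided bound is applied to \<open>V\<close> and \<open>- V\<close>; the
  derivative is odd in the direction, the entrywise norm even.\<close>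

lemma S_loc_deriv_bound:
  assumes "X \<in> S_loc H \<mu>" "0 \<le> \<mu>"
  shows "\<bar>E\<^sub>0_deriv H X V\<bar> \<le> \<mu> * entry_norm V"
proof -
  have "X \<in> local_minimizers (\<lambda>Y. E\<^sub>0 H Y + \<mu> * entry_norm Y)"
    using assms(1) by (simp add: S_loc_def E_def[abs_def] entry_norm_def)
  then have ge: "- (\<mu> * entry_norm W) \<le> E\<^sub>0_deriv H X W" for W
    using local_minimizer_directional_bound[OF has_derivative_E\<^sub>0] entry_norm_add_scaleR assms(2)
    by blast
  have "E\<^sub>0_deriv H X (- V) = - E\<^sub>0_deriv H X V"
    using has_derivative_linear[OF has_derivative_E\<^sub>0] by (rule linear_neg)
  then show ?thesis
    using ge[of V] ge[of "- V"] by (simp add: entry_norm_minus)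
qed

text \<open>In the direction \<open>X\<close> itself, a quartic lower bound for the derivative meets
  an upper bound linear in \<open>norm X\<close>.\<close>

lemma S_loc_bounded:
  fixes H :: "complex ^ 'n ^ 'n"
  assumes "negative_definite H"
  obtains R where "\<And>\<mu> (X :: complex ^ 'm ^ 'n). X \<in> S_loc H \<mu> \<Longrightarrow> 0 \<le> \<mu> \<Longrightarrow> \<mu> \<le> 1 \<Longrightarrow> norm X \<le> R"
proof -
  obtain U :: "complex ^ 'm ^ 'n" where U: "\<And>X :: complex ^ 'm ^ 'n. quad H U * (norm X)\<^sup>2 \<le> quad H X"
    by (rule quadratic_ge_unit_value[OF continuous_on_quad[of UNIV H] quad_scaleR]) blast
  \<comment> \<open>The form is negated here, so \<open>- quad H W\<close> is a positive coercivity
    constant on square matrices.\<close>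
  obtain W :: "complex ^ 'n ^ 'n" where "norm W = 1"
    and W: "\<And>Y :: complex ^ 'n ^ 'n. - quad H W * (norm Y)\<^sup>2 \<le> - quad H Y"
    by (rule quadratic_ge_unit_value[of "\<lambda>Y :: complex ^ 'n ^ 'n. - quad H Y"])
      (auto intro!: continuous_intros continuous_on_quad simp: quad_scaleR)
  \<comment> \<open>Dividing by the squared dimension absorbs the factor from comparing
    \<open>(norm X)\<^sup>2\<close> with \<open>norm (X ** ctranspose X)\<close>.\<close>
  define a where "a = - quad H W / (real CARD('n))\<^sup>2"
  define L where "L = real (CARD('n) * CARD('m))"
  have "quad H W < 0"
    using \<open>norm W = 1\<close> by (intro quad_neg assms) auto
  then have "0 < a"
    by (simp add: a_def divide_neg_pos)
  \<comment> \<open>Outside the unit ball \<open>r \<le> r\<^sup>2\<close> holds. It lets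
    \<open>r\<^sup>2\<close> cancel from the quartic inequality and afterwards makes the bound
    linear in \<open>r\<close>.\<close>
  have "norm X \<le> max 1 ((L - 4 * quad H U) / (4 * a))"
    if X: "X \<in> S_loc H \<mu>" and \<mu>: "0 \<le> \<mu>" "\<mu> \<le> 1" for \<mu> and X :: "complex ^ 'm ^ 'n"
  proof (cases "norm X \<le> 1")
    case False
    define r where "r = norm X"
    have r: "1 < r" using False by (simp add: r_def)
    have "(r\<^sup>2)\<^sup>2 \<le> (real CARD('n) * norm (X ** ctranspose X))\<^sup>2"
      unfolding r_def by (intro power_mono norm_power2_le_norm_mult_ctranspose) simp
    then have "a * (r\<^sup>2)\<^sup>2 \<le> a * (real CARD('n) * norm (X ** ctranspose X))\<^sup>2"
      using \<open>0 < a\<close> by simp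
    also have "\<dots> = - quad H W * (norm (X ** ctranspose X))\<^sup>2"
      by (simp add: a_def power_mult_distrib)
    also have "\<dots> \<le> - quad H (X ** ctranspose X)"
      by (rule W)
    finally have "4 * a * (r\<^sup>2)\<^sup>2 + 4 * quad H U * r\<^sup>2 \<le> E\<^sub>0_deriv H X X"
      using U[of X] by (simp add: E\<^sub>0_deriv_self r_def)
    also have "\<dots> \<le> \<mu> * entry_norm X"
      using S_loc_deriv_bound[OF X \<mu>(1), of X] by simp
    also have "\<dots> \<le> 1 * (L * r)"
      using \<mu> entry_norm_le[of X] entry_norm_nonneg[of X] unfolding L_def r_def
      by (intro mult_mono) auto
    also have "\<dots> \<le> L * r\<^sup>2"
      using r by (simp add: L_def power2_eq_square)
    finally have "(4 * a * r\<^sup>2) * r\<^sup>2 \<le> (L - 4 * quad H U) * r\<^sup>2"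
      by (simp add: algebra_simps power2_eq_square)
    then have "4 * a * r\<^sup>2 \<le> L - 4 * quad H U"
      using r by (simp add: mult_le_cancel_right)
    moreover have "4 * a * r \<le> 4 * a * r\<^sup>2"
      using r \<open>0 < a\<close> by (simp add: power2_eq_square)
    ultimately have "4 * a * r \<le> L - 4 * quad H U"
      by (rule order_trans[rotated])
    then have "r \<le> (L - 4 * quad H U) / (4 * a)"
      using \<open>0 < a\<close> by (simp add: pos_le_divide_eq mult_ac)
    then show ?thesis by (simp add: r_def)
  qed simp
  then show thesis by (intro that)
qed

section \<open>Critical points and the limit of small \<open>\<mu>\<close>\<close>

text \<open>By linearity, finitely many directions detect a critical point, so criticality becomes
  the vanishing of one continuous function.\<close>

lemma in_C\<^sub>p_iff: "X \<in> C\<^sub>p H \<longleftrightarrow> (\<forall>b\<in>Basis. E\<^sub>0_deriv H X b = 0)"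
proof -
  have "X \<in> C\<^sub>p H \<longleftrightarrow> E\<^sub>0_deriv H X = (\<lambda>_. 0)"
    using has_derivative_unique[OF has_derivative_E\<^sub>0] has_derivative_E\<^sub>0[of H X]
    by (auto simp: C\<^sub>p_def gderiv_def)
  also have "\<dots> \<longleftrightarrow> (\<forall>b\<in>Basis. E\<^sub>0_deriv H X b = 0)"
    using linear_eq_stdbasis[OF has_derivative_linear[OF has_derivative_E\<^sub>0[of H X]] linear_zero]
    by auto
  finally show ?thesis .
qed

theorem theorem4:
  fixes H :: "complex ^ 'n ^ 'n"
  assumes "hermitian H"
    and "negative_definite H"
  shows "\<forall>\<epsilon>>0. \<exists>\<delta>>0. \<forall>\<mu>. 0 \<le> \<mu> \<and> \<mu> < \<delta> \<longrightarrow>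
    dist_sets (S_loc H \<mu> :: (complex ^ 'm ^ 'n) set) (C\<^sub>p H) < ennreal \<epsilon>"
proof (intro allI impI)
  fix \<epsilon> :: real assume "0 < \<epsilon>"
  \<comment> \<open>A continuous stand-in for the size of the gradient, vanishing exactly on
    \<open>C\<^sub>p H\<close>; the derivative bound gives \<open>\<phi> X \<le> \<mu> * B\<close>
    at local minimizers.\<close>
  define \<phi> where "\<phi> X = (\<Sum>b\<in>Basis. \<bar>E\<^sub>0_deriv H X b\<bar>)" for X :: "complex ^ 'm ^ 'n"
  define B where "B = (\<Sum>b\<in>Basis. entry_norm (b :: complex ^ 'm ^ 'n))"
  have "0 \<le> B"
    unfolding B_def by (intro sum_nonneg entry_norm_nonneg)
  obtain R where R: "\<And>\<mu> (X :: complex ^ 'm ^ 'n). X \<in> S_loc H \<mu> \<Longrightarrow> 0 \<le> \<mu> \<Longrightarrow> \<mu> \<le> 1 \<Longrightarrow> norm X \<le> R"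
    by (rule S_loc_bounded[OF assms(2)]) (erule that)
  \<comment> \<open>Half of \<open>\<epsilon>\<close> is aimed at because the supremum only
    preserves a weak inequality.\<close>
  have "0 < \<epsilon> / 2" using \<open>0 < \<epsilon>\<close> by simp
  then obtain c where "0 < c"
    and c: "\<And>X :: complex ^ 'm ^ 'n. X \<in> cball 0 R \<Longrightarrow> \<phi> X < c \<Longrightarrow> infdist X (C\<^sub>p H) < \<epsilon> / 2"
  proof (rule near_zero_set_if_small[of "cball 0 R" \<phi> "C\<^sub>p H" "\<epsilon> / 2", rotated 4])
    show "continuous_on (cball 0 R) \<phi>"
      unfolding \<phi>_def by (intro continuous_intros continuous_on_E\<^sub>0_deriv)
    show "0 \<le> \<phi> X" for X
      unfolding \<phi>_def by (intro sum_nonneg) simp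
    show "X \<in> C\<^sub>p H" if "\<phi> X = 0" for X
      using that by (simp add: \<phi>_def in_C\<^sub>p_iff sum_nonneg_eq_0_iff)
  qed auto
  \<comment> \<open>The 1 in the minimum makes the radius \<open>R\<close> valid;
    \<open>B + 1\<close> ensures a positive denominator.\<close>
  define \<delta> where "\<delta> = min 1 (c / (B + 1))"
  have "0 < \<delta>"
    using \<open>0 < c\<close> \<open>0 \<le> B\<close> by (simp add: \<delta>_def)
  moreover have "dist_sets (S_loc H \<mu> :: (complex ^ 'm ^ 'n) set) (C\<^sub>p H) < ennreal \<epsilon>"
    if \<mu>: "0 \<le> \<mu>" "\<mu> < \<delta>" for \<mu>
  proof -
    have "infdist X (C\<^sub>p H) < \<epsilon> / 2" if X: "X \<in> S_loc H \<mu>" for X :: "complex ^ 'm ^ 'n"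
    proof (rule c)
      show "X \<in> cball 0 R"
        using R[OF X] \<mu> by (simp add: \<delta>_def)
      have "\<phi> X \<le> \<mu> * B"
        unfolding \<phi>_def B_def sum_distrib_left
        by (intro sum_mono S_loc_deriv_bound X \<mu>)
      also have "\<dots> \<le> \<mu> * (B + 1)"
        using \<mu> by (simp add: mult_left_mono)
      also have "\<dots> < c"
        using \<mu> \<open>0 \<le> B\<close> by (simp add: \<delta>_def pos_less_divide_eq)
      finally show "\<phi> X < c" .
    qed
    \<comment> \<open>The zero matrix shows that the critical set is nonempty, as
      \<open>dist_sets_le\<close> demands.\<close>
    moreover have "(0 :: complex ^ 'm ^ 'n) \<in> C\<^sub>p H"
      using ctranspose_scaleR[of 0 "0 :: complex ^ 'm ^ 'n"]
      by (simp add: in_C\<^sub>p_iff E\<^sub>0_deriv_def quad_deriv_def trace_def)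
    ultimately have "dist_sets (S_loc H \<mu> :: (complex ^ 'm ^ 'n) set) (C\<^sub>p H) \<le> ennreal (\<epsilon> / 2)"
      by (intro dist_sets_le) auto
    also have "\<dots> < ennreal \<epsilon>"
      using \<open>0 < \<epsilon>\<close> by (intro ennreal_lessI) auto
    finally show ?thesis .
  qed
  ultimately show "\<exists>\<delta>>0. \<forall>\<mu>. 0 \<le> \<mu> \<and> \<mu> < \<delta> \<longrightarrow>
      dist_sets (S_loc H \<mu> :: (complex ^ 'm ^ 'n) set) (C\<^sub>p H) < ennreal \<epsilon>"
    by blast
qed

end
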